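(* For every integer $n\ge 1$, the matrix ring over dual numbers $M_n(\mathbb{D})$ is $\pi$-regular.
   Context: $\mathbb{D}=\{a+b\epsilon \mid a,b\in\mathbb{R},\ \epsilon^2=0\}$ is the ring of dual numbers, and $M_n(\mathbb{D})$ is the ring of $n\times n$ matrices over $\mathbb{D}$. An element $a$ of a ring $R$ (associative with identity) is $\pi$-regular if there exist an integer $m\ge 1$ and $x\in R$ with $a^m=a^mxa^m$. A ring is $\pi$-regular if every element of it is $\pi$-regular. *)

theory Defs
  imports Complex_Main "HOL-Algebra.Ring" "Jordan_Normal_Form.Matrix"
begin

section \<open>Dual numbers\<close>

text \<open>\<open>Dual a b\<close> stands for \<open>a + b \<epsilon>\<close>; see \<open>dual_eq\<close> and \<open>eps_squared\<close> below.\<close>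

datatype dual = Dual (std_part: real) (eps_part: real)

lemma dual_eq_iff: "x = y \<longleftrightarrow> std_part x = std_part y \<and> eps_part x = eps_part y"
  by (auto intro: dual.expand)

instantiation dual :: comm_ring_1
begin

definition zero_dual :: dual where "0 = Dual 0 0"

definition one_dual :: dual where "1 = Dual 1 0"

definition plus_dual :: "dual \<Rightarrow> dual \<Rightarrow> dual" where
  "x + y = Dual (std_part x + std_part y) (eps_part x + eps_part y)"

definition uminus_dual :: "dual \<Rightarrow> dual" where
  "- x = Dual (- std_part x) (- eps_part x)"

definition minus_dual :: "dual \<Rightarrow> dual \<Rightarrow> dual" where
  "x - y = Dual (std_part x - std_part y) (eps_part x - eps_part y)"

definition times_dual :: "dual \<Rightarrow> dual \<Rightarrow> dual" where
  "x * y = Dual (std_part x * std_part y)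
                (std_part x * eps_part y + eps_part x * std_part y)"

instance
  by standard
    (simp_all add: dual_eq_iff zero_dual_def one_dual_def plus_dual_def uminus_dual_def
      minus_dual_def times_dual_def algebra_simps)

end

instantiation dual :: real_algebra_1
begin

definition scaleR_dual :: "real \<Rightarrow> dual \<Rightarrow> dual" where
  "c *\<^sub>R x = Dual (c * std_part x) (c * eps_part x)"

instance
  by standard
    (simp_all add: dual_eq_iff scaleR_dual_def plus_dual_def times_dual_def algebra_simps)

end

definition eps :: dual where "eps = Dual 0 1"

lemma eps_squared: "eps ^ 2 = 0"
  by (simp add: eps_def power2_eq_square times_dual_def zero_dual_def)

lemma dual_eq: "Dual a b = of_real a + of_real b * eps"
  by (simp add: eps_def of_real_def scaleR_dual_def one_dual_def plus_dual_def times_dual_def)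


section \<open>\<open>\<pi>\<close>-regularity\<close>

definition pi_regular_element :: "('a, 'b) ring_scheme \<Rightarrow> 'a \<Rightarrow> bool" where
  "pi_regular_element R a \<longleftrightarrow>
     (\<exists>m::nat. m \<ge> 1 \<and>
       (\<exists>x\<in>carrier R. a [^]\<^bsub>R\<^esub> m = a [^]\<^bsub>R\<^esub> m \<otimes>\<^bsub>R\<^esub> x \<otimes>\<^bsub>R\<^esub> a [^]\<^bsub>R\<^esub> m))"

definition pi_regular_ring :: "('a, 'b) ring_scheme \<Rightarrow> bool" where
  "pi_regular_ring R \<longleftrightarrow> ring R \<and> (\<forall>a\<in>carrier R. pi_regular_element R a)"

end

theory Submission
  imports Defs "Jordan_Normal_Form.Determinant"
begin

text \<open>
  The ring \<open>M\<^sub>n(\<D>)\<close> is a real algebra of dimension \<open>2n\<^sup>2\<close>, so the powers of a matrix \<open>A\<close> satisfy a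
  nontrivial real linear relation. Solving it for the lowest power that occurs gives
  \<open>A\<^sup>m = A\<^sup>m\<^sup>+\<^sup>1 S\<close>, where \<open>S\<close> is a polynomial in \<open>A\<close> and hence commutes with \<open>A\<close>. Iterating,
  \<open>A\<^sup>m = A\<^sup>2\<^sup>m S\<^sup>m = A\<^sup>m S\<^sup>m A\<^sup>m\<close>.
\<close>

text \<open>There is one more unknown than there are equations. The equations carry an arbitrary
  finite index set, so that matrix coordinates can later label them directly.\<close>

lemma homogeneous_system_nontrivial_solution:
  fixes f :: "'i \<Rightarrow> nat \<Rightarrow> 'a::field"
  assumes "finite I"
  obtains c where "\<exists>k\<le>card I. c k \<noteq> 0" and "\<And>i. i \<in> I \<Longrightarrow> (\<Sum>k\<le>card I. c k * f i k) = 0"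
proof -
  let ?d = "card I"
  obtain h where h: "bij_betw h {0..<?d} I"
    using ex_bij_betw_nat_finite[OF assms] by blast
  \<comment> \<open>A zero row pads the \<open>?d\<close> equations, enumerated by \<open>h\<close>,
    to a square matrix. Its determinant vanishes, so it has a nonzero kernel vector.\<close>
  define M where "M = mat\<^sub>r (Suc ?d) (Suc ?d)
    (\<lambda>r. if r = ?d then 0\<^sub>v (Suc ?d) else vec (Suc ?d) (f (h r)))"
  have M: "M \<in> carrier_mat (Suc ?d) (Suc ?d)"
    by (simp add: M_def)
  have "det M = 0"
    unfolding M_def by (rule det_row_0) auto
  then obtain v where v: "v \<in> carrier_vec (Suc ?d)" "v \<noteq> 0\<^sub>v (Suc ?d)"
      and Mv: "M *\<^sub>v v = 0\<^sub>v (Suc ?d)"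
    using det_0_iff_vec_prod_zero_field[OF M] by auto
  show thesis
  proof (rule that[of "\<lambda>k. v $ k"])
    show "\<exists>k\<le>?d. v $ k \<noteq> 0"
    proof (rule ccontr)
      assume "\<not> ?thesis"
      then have "v = 0\<^sub>v (Suc ?d)"
        using v(1) by (intro eq_vecI) (auto simp: less_Suc_eq_le)
      with v(2) show False ..
    qed
  next
    fix i assume "i \<in> I"
    then have "i \<in> h ` {0..<?d}"
      by (simp only: bij_betw_imp_surj_on[OF h])
    then obtain r where r: "r < ?d" "i = h r"
      by auto
    have "0 = (M *\<^sub>v v) $ r"
      using r by (simp add: Mv)
    also have "\<dots> = (\<Sum>k\<le>?d. v $ k * f i k)"
      using r v(1)
      by (auto simp: M_def scalar_prod_def mult.commute lessThan_Suc_atMost atLeast0LessThan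
          intro!: sum.cong)
    finally show "(\<Sum>k\<le>?d. v $ k * f i k) = 0" ..
  qed
qed

text \<open>Each use of \<open>eq\<close> raises the exponent of \<open>a\<close> by one at the cost
  of a factor \<open>s\<close>. Once the exponent has doubled, commutation moves the power of
  \<open>s\<close> between two equal powers of \<open>a\<close>.\<close>

lemma (in ring) pi_regular_element_if_strongly_pi_regular:
  assumes a: "a \<in> carrier R" and s: "s \<in> carrier R" and comm: "a \<otimes> s = s \<otimes> a"
    and eq: "a [^] (m::nat) = a [^] Suc m \<otimes> s"
  shows "pi_regular_element R a"
proof -
  have iter: "a [^] m = a [^] (m + j) \<otimes> s [^] j" for j :: nat
  proof (induction j)
    case 0
    then show ?case using a s by simp
  next
    case (Suc j)
    \<comment> \<open>This is \<open>eq\<close> multiplied on the left by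
      \<open>a [^] j\<close>.\<close>
    have "a [^] (m + j) = a [^] (m + Suc j) \<otimes> s"
    proof -
      have "a [^] (m + j) = a [^] j \<otimes> a [^] m"
        using a by (simp add: nat_pow_mult add.commute)
      also have "\<dots> = a [^] j \<otimes> a [^] Suc m \<otimes> s"
        using a s by (simp only: eq) (simp add: m_assoc)
      also have "a [^] j \<otimes> a [^] Suc m = a [^] (m + Suc j)"
        using nat_pow_mult[OF a, of j "Suc m"] by (simp add: add.commute)
      finally show ?thesis .
    qed
    then have "a [^] m = a [^] (m + Suc j) \<otimes> s \<otimes> s [^] j"
      using Suc.IH by (rule subst[of _ _ "\<lambda>x. a [^] m = x \<otimes> s [^] j"])
    also have "\<dots> = a [^] (m + Suc j) \<otimes> s [^] Suc j"
      unfolding nat_pow_Suc2[OF s] using a s by (intro m_assoc) auto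
    finally show ?case .
  qed
  have comm_pow: "a [^] i \<otimes> s [^] j = s [^] j \<otimes> a [^] i" for i j :: nat
    by (rule group_commutes_pow[OF group_commutes_pow[OF comm a s, of i, symmetric], symmetric])
      (use a s in auto)
  \<comment> \<open>The exponent of the definition must be at least 1, whereas \<open>m\<close> may
    be 0, namely when \<open>a\<close> is invertible with inverse \<open>s\<close>.\<close>
  let ?k = "Suc m"
  have "a [^] ?k = a [^] (1::nat) \<otimes> a [^] m"
    using nat_pow_mult[OF a, of 1 m] by simp
  also have "\<dots> = a [^] (1::nat) \<otimes> a [^] (m + ?k) \<otimes> s [^] ?k"
    using a s by (subst iter[of ?k]) (simp add: m_assoc del: nat_pow_Suc)
  also have "a [^] (1::nat) \<otimes> a [^] (m + ?k) = a [^] ?k \<otimes> a [^] ?k"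
    using nat_pow_mult[OF a, of 1 "m + ?k"] nat_pow_mult[OF a, of ?k ?k] by simp
  also have "\<dots> \<otimes> s [^] ?k = a [^] ?k \<otimes> s [^] ?k \<otimes> a [^] ?k"
    by (simp only: m_assoc nat_pow_closed[OF a] nat_pow_closed[OF s]
        comm_pow[of ?k ?k, symmetric])
  finally show ?thesis
    unfolding pi_regular_element_def using s by (intro exI[of _ ?k]) auto
qed

text \<open>A real polynomial of degree below \<open>d\<close> evaluated at \<open>A\<close>. It is
  written entrywise because matrices of all sizes share one type, so an empty sum of matrices would
  have no definite size.\<close>

definition mat_poly :: "(nat \<Rightarrow> real) \<Rightarrow> nat \<Rightarrow> 'a::real_algebra_1 mat \<Rightarrow> 'a mat" where
  "mat_poly b d A = mat (dim_row A) (dim_row A) (\<lambda>(i, j). \<Sum>t<d. b t *\<^sub>R (A ^\<^sub>m t) $$ (i, j))"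

lemma pow_mat_add:
  fixes A :: "'a::semiring_1 mat"
  assumes A: "A \<in> carrier_mat n n"
  shows "A ^\<^sub>m (p + q) = A ^\<^sub>m p * A ^\<^sub>m q"
proof -
  interpret semiring "ring_mat TYPE('a) n ()" by (rule semiring_mat)
  show ?thesis
    using A nat_pow_mult[of A p q]
    by (simp add: pow_mat_ring_pow[OF A, of _ "()"] ring_mat_simps)
qed

lemma pow_mult_mat_poly:
  assumes A: "A \<in> carrier_mat n n"
  shows "A ^\<^sub>m p * mat_poly b d A = mat n n (\<lambda>(i, j). \<Sum>t<d. b t *\<^sub>R (A ^\<^sub>m (p + t)) $$ (i, j))"
proof (rule eq_matI)
  fix i j
  assume "i < dim_row (mat n n (\<lambda>(i, j). \<Sum>t<d. b t *\<^sub>R (A ^\<^sub>m (p + t)) $$ (i, j)))"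
    "j < dim_col (mat n n (\<lambda>(i, j). \<Sum>t<d. b t *\<^sub>R (A ^\<^sub>m (p + t)) $$ (i, j)))"
  then have ij: "i < n" "j < n" by auto
  have P: "A ^\<^sub>m t \<in> carrier_mat n n" for t
    using A by (rule pow_carrier_mat)
  have "(A ^\<^sub>m p * mat_poly b d A) $$ (i, j)
      = (\<Sum>l<n. (A ^\<^sub>m p) $$ (i, l) * (\<Sum>t<d. b t *\<^sub>R (A ^\<^sub>m t) $$ (l, j)))"
    using ij A P[of p] by (simp add: mat_poly_def scalar_prod_def atLeast0LessThan)
  also have "\<dots> = (\<Sum>t<d. b t *\<^sub>R (\<Sum>l<n. (A ^\<^sub>m p) $$ (i, l) * (A ^\<^sub>m t) $$ (l, j)))"
    unfolding sum_distrib_left scaleR_sum_right by (subst sum.swap) simp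
  also have "\<dots> = (\<Sum>t<d. b t *\<^sub>R (A ^\<^sub>m (p + t)) $$ (i, j))"
    using ij P A by (simp add: pow_mat_add[OF A] scalar_prod_def atLeast0LessThan carrier_matD[OF P])
  finally show "(A ^\<^sub>m p * mat_poly b d A) $$ (i, j)
      = mat n n (\<lambda>(i, j). \<Sum>t<d. b t *\<^sub>R (A ^\<^sub>m (p + t)) $$ (i, j)) $$ (i, j)"
    using ij by simp
qed (use A in \<open>auto simp: mat_poly_def\<close>)

text \<open>The right-hand side agrees with that of \<open>pow_mult_mat_poly\<close>, so the two
  lemmas show that \<open>A\<close> commutes with its polynomials. Real coefficients are central,
  hence the entries themselves need not commute.\<close>

lemma mat_poly_mult_pow:
  assumes A: "A \<in> carrier_mat n n"
  shows "mat_poly b d A * A ^\<^sub>m p = mat n n (\<lambda>(i, j). \<Sum>t<d. b t *\<^sub>R (A ^\<^sub>m (p + t)) $$ (i, j))"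
proof (rule eq_matI)
  fix i j
  assume "i < dim_row (mat n n (\<lambda>(i, j). \<Sum>t<d. b t *\<^sub>R (A ^\<^sub>m (p + t)) $$ (i, j)))"
    "j < dim_col (mat n n (\<lambda>(i, j). \<Sum>t<d. b t *\<^sub>R (A ^\<^sub>m (p + t)) $$ (i, j)))"
  then have ij: "i < n" "j < n" by auto
  have P: "A ^\<^sub>m t \<in> carrier_mat n n" for t
    using A by (rule pow_carrier_mat)
  have "(mat_poly b d A * A ^\<^sub>m p) $$ (i, j)
      = (\<Sum>l<n. (\<Sum>t<d. b t *\<^sub>R (A ^\<^sub>m t) $$ (i, l)) * (A ^\<^sub>m p) $$ (l, j))"
    using ij A P[of p] by (simp add: mat_poly_def scalar_prod_def atLeast0LessThan)
  also have "\<dots> = (\<Sum>t<d. b t *\<^sub>R (\<Sum>l<n. (A ^\<^sub>m t) $$ (i, l) * (A ^\<^sub>m p) $$ (l, j)))"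
    unfolding sum_distrib_right scaleR_sum_right by (subst sum.swap) simp
  also have "\<dots> = (\<Sum>t<d. b t *\<^sub>R (A ^\<^sub>m (t + p)) $$ (i, j))"
    using ij P A by (simp add: pow_mat_add[OF A] scalar_prod_def atLeast0LessThan carrier_matD[OF P])
  finally show "(mat_poly b d A * A ^\<^sub>m p) $$ (i, j)
      = mat n n (\<lambda>(i, j). \<Sum>t<d. b t *\<^sub>R (A ^\<^sub>m (p + t)) $$ (i, j)) $$ (i, j)"
    using ij by (simp add: add.commute)
qed (use A in \<open>auto simp: mat_poly_def\<close>)

lemma std_part_sum_scaleR: "std_part (\<Sum>t\<in>T. c t *\<^sub>R x t) = (\<Sum>t\<in>T. c t * std_part (x t))"
  by (induction T rule: infinite_finite_induct) (simp_all add: zero_dual_def plus_dual_def scaleR_dual_def)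

lemma eps_part_sum_scaleR: "eps_part (\<Sum>t\<in>T. c t *\<^sub>R x t) = (\<Sum>t\<in>T. c t * eps_part (x t))"
  by (induction T rule: infinite_finite_induct) (simp_all add: zero_dual_def plus_dual_def scaleR_dual_def)

text \<open>Each matrix has \<open>2 * n * n\<close> real coordinates, so that many powers plus one
  are linearly dependent over the reals.\<close>

lemma dual_mat_powers_linear_relation:
  fixes A :: "dual mat"
  obtains c :: "nat \<Rightarrow> real" and N where "\<exists>k\<le>N. c k \<noteq> 0"
    and "\<And>i j. i < n \<Longrightarrow> j < n \<Longrightarrow> (\<Sum>k\<le>N. c k *\<^sub>R (A ^\<^sub>m k) $$ (i, j)) = 0"
proof -
  \<comment> \<open>The two projections themselves serve as labels: one real equation for each entry
    and each of its parts.\<close>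
  let ?I = "{..<n} \<times> {..<n} \<times> {std_part, eps_part}"
  obtain c where c: "\<exists>k\<le>card ?I. c k \<noteq> 0"
      "\<And>x. x \<in> ?I \<Longrightarrow>
        (\<Sum>k\<le>card ?I. c k * (case x of (i, j, part) \<Rightarrow> part ((A ^\<^sub>m k) $$ (i, j)))) = 0"
    using homogeneous_system_nontrivial_solution
      [of ?I "\<lambda>(i, j, part) k. part ((A ^\<^sub>m k) $$ (i, j))"]
    by (auto simp: case_prod_unfold)
  show thesis
  proof (rule that[OF c(1)])
    fix i j assume "i < n" "j < n"
    then show "(\<Sum>k\<le>card ?I. c k *\<^sub>R (A ^\<^sub>m k) $$ (i, j)) = 0"
      using c(2)[of "(i, j, std_part)"] c(2)[of "(i, j, eps_part)"]
      by (simp add: dual_eq_iff std_part_sum_scaleR eps_part_sum_scaleR zero_dual_def)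
  qed
qed

lemma dual_mat_pow_eq_pow_Suc_mult_mat_poly:
  fixes A :: "dual mat"
  assumes A: "A \<in> carrier_mat n n"
  obtains m b d where "A ^\<^sub>m m = A ^\<^sub>m Suc m * mat_poly b d A"
proof -
  obtain c :: "nat \<Rightarrow> real" and N where c: "\<exists>k\<le>N. c k \<noteq> 0"
    and rel: "\<And>i j. i < n \<Longrightarrow> j < n \<Longrightarrow> (\<Sum>k\<le>N. c k *\<^sub>R (A ^\<^sub>m k) $$ (i, j)) = 0"
    using dual_mat_powers_linear_relation[of n A] by metis
  define m where "m = (LEAST k. c k \<noteq> 0)"
  obtain k where k: "k \<le> N" "c k \<noteq> 0"
    using c by auto
  have cm: "c m \<noteq> 0"
    unfolding m_def by (rule LeastI, rule k(2))
  have below: "c k = 0" if "k < m" for k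
    using not_less_Least[OF that[unfolded m_def]] by simp
  have mN: "m \<le> N"
    using Least_le[of "\<lambda>k. c k \<noteq> 0" k, OF k(2)] k(1) unfolding m_def by (rule order_trans)
  \<comment> \<open>Solving for the power \<open>m\<close> divides by \<open>c m\<close>; pulling
    out \<open>Suc m\<close> factors of \<open>A\<close> shifts the index. If \<open>m = N\<close>,
    the polynomial is empty and the relation says that the power \<open>m\<close> of
    \<open>A\<close> is zero.\<close>
  let ?b = "\<lambda>t. - (c (Suc m + t) / c m)"
  show thesis
  proof (rule that[of m ?b "N - m"], unfold pow_mult_mat_poly[OF A], rule eq_matI)
    fix i j
    assume "i < dim_row (mat n n (\<lambda>(i, j). \<Sum>t<N - m. ?b t *\<^sub>R (A ^\<^sub>m (Suc m + t)) $$ (i, j)))"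
      "j < dim_col (mat n n (\<lambda>(i, j). \<Sum>t<N - m. ?b t *\<^sub>R (A ^\<^sub>m (Suc m + t)) $$ (i, j)))"
    then have ij: "i < n" "j < n" by auto
    let ?v = "\<lambda>k. (A ^\<^sub>m k) $$ (i, j)"
    \<comment> \<open>The first block contributes nothing by minimality of \<open>m\<close>, and the
      last is already indexed as in \<open>?b\<close>.\<close>
    have split: "{..N} = {..<m} \<union> {m} \<union> (\<lambda>t. Suc m + t) ` {..<N - m}"
    proof -
      have "(\<lambda>t. Suc m + t) ` {..<N - m} = {Suc m..N}"
        unfolding lessThan_atLeast0 image_add_atLeastLessThan using mN by auto
      then show ?thesis using mN by auto
    qed
    have "0 = (\<Sum>k\<le>N. c k *\<^sub>R ?v k)"
      using rel[OF ij] ..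
    also have "\<dots> = (\<Sum>k<m. c k *\<^sub>R ?v k) + c m *\<^sub>R ?v m
        + (\<Sum>k\<in>(\<lambda>t. Suc m + t) ` {..<N - m}. c k *\<^sub>R ?v k)"
      unfolding split by (subst sum.union_disjoint; force simp: add.commute)
    also have "\<dots> = c m *\<^sub>R ?v m + (\<Sum>t<N - m. c (Suc m + t) *\<^sub>R ?v (Suc m + t))"
      by (simp add: below sum.reindex inj_on_def)
    finally have "c m *\<^sub>R ?v m = - (\<Sum>t<N - m. c (Suc m + t) *\<^sub>R ?v (Suc m + t))"
      by (simp add: eq_neg_iff_add_eq_0)
    then have "inverse (c m) *\<^sub>R c m *\<^sub>R ?v m
        = inverse (c m) *\<^sub>R - (\<Sum>t<N - m. c (Suc m + t) *\<^sub>R ?v (Suc m + t))"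
      by (rule arg_cong)
    then have "?v m = (\<Sum>t<N - m. ?b t *\<^sub>R ?v (Suc m + t))"
      using cm by (simp add: scaleR_sum_right sum_negf[symmetric] divide_inverse mult.commute)
    then show "?v m = mat n n (\<lambda>(i, j). \<Sum>t<N - m. ?b t *\<^sub>R (A ^\<^sub>m (Suc m + t)) $$ (i, j)) $$ (i, j)"
      using ij by simp
  qed (use A in auto)
qed

theorem proposition3p9:
  fixes n :: nat
  assumes "n \<ge> 1"
  shows "pi_regular_ring (ring_mat TYPE(dual) n ())"
proof -
  let ?R = "ring_mat TYPE(dual) n ()"
  interpret ring ?R by (rule ring_mat)
  have "pi_regular_element ?R A" if "A \<in> carrier ?R" for A
  proof -
    from that have A: "A \<in> carrier_mat n n"
      by (simp add: ring_mat_simps)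
    obtain m b d where eq: "A ^\<^sub>m m = A ^\<^sub>m Suc m * mat_poly b d A"
      using dual_mat_pow_eq_pow_Suc_mult_mat_poly[OF A] .
    have S: "mat_poly b d A \<in> carrier_mat n n"
      using A by (simp add: mat_poly_def)
    \<comment> \<open>Both products equal the same entrywise sum, by the two product formulas with
      \<open>p = 1\<close>.\<close>
    have comm: "A * mat_poly b d A = mat_poly b d A * A"
      using pow_mult_mat_poly[OF A, of 1 b d] mat_poly_mult_pow[OF A, of b d 1] A by simp
    show ?thesis
    proof (rule pi_regular_element_if_strongly_pi_regular)
      show "A [^]\<^bsub>?R\<^esub> m = A [^]\<^bsub>?R\<^esub> Suc m \<otimes>\<^bsub>?R\<^esub> mat_poly b d A"
        using eq unfolding pow_mat_ring_pow[OF A, of _ "()", symmetric]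
        by (simp only: ring_mat_simps)
    qed (use A S comm in \<open>simp_all add: ring_mat_simps\<close>)
  qed
  then show ?thesis
    by (simp add: pi_regular_ring_def ring_mat)
qed

end
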